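(* Let $\beta\ge 3$ and let $E\subseteq\mathbb{R}$ be the self-similar set generated by the iterated function system $\{f_0,f_1,f_{\beta+1}\}$, where $f_d(x)=\frac{x+d}{\beta}$ for $d\in\{0,1,\beta+1\}$. If $g$ is an affine map such that $g(E)\subseteq E$, then $g=f_{\mathbf i}$ for some $\mathbf i\in\Omega^*$.
   Context: $E$ is the unique non-empty compact subset of $\mathbb{R}$ with $E=f_0(E)\cup f_1(E)\cup f_{\beta+1}(E)$. $\Omega=\{0,1,\beta+1\}$ is the alphabet, $\Omega^n$ is the set of all blocks $d_1\ldots d_n$ of length $n$ with $d_i\in\Omega$, and $\Omega^*=\bigcup_{n=1}^\infty\Omega^n$. For $\mathbf i=d_1\ldots d_n\in\Omega^n$, $f_{\mathbf i}=f_{d_1}\circ\cdots\circ f_{d_n}$.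
   Formalization: The affine map g is assumed to be non-constant and different from the identity: the identity and the constant maps to points of E send E into E but are not of the form f_i with i a block of length at least 1. *)

theory Defs
  imports "HOL-Analysis.Analysis"
begin

definition self_similar_set :: "(real \<Rightarrow> real) set \<Rightarrow> real set \<Rightarrow> bool" where
  "self_similar_set F E \<longleftrightarrow> E \<noteq> {} \<and> compact E \<and> E = (\<Union>\<phi>\<in>F. \<phi> ` E)"

definition fmap :: "real \<Rightarrow> real \<Rightarrow> real \<Rightarrow> real" where
  "fmap \<beta> d x = (x + d) / \<beta>"

definition Omega :: "real \<Rightarrow> real set" where
  "Omega \<beta> = {0, 1, \<beta> + 1}"

definition blocks :: "real \<Rightarrow> nat \<Rightarrow> real list set" where
  "blocks \<beta> n = {w. length w = n \<and> set w \<subseteq> Omega \<beta>}"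

text \<open>The empty block is excluded.\<close>
definition Omega_star :: "real \<Rightarrow> real list set" where
  "Omega_star \<beta> = (\<Union>n\<in>{1..}. blocks \<beta> n)"

text \<open>The first letter of the block is the outermost map.\<close>
definition fword :: "real \<Rightarrow> real list \<Rightarrow> real \<Rightarrow> real" where
  "fword \<beta> w = foldr (\<lambda>d h. fmap \<beta> d \<circ> h) w id"

text \<open>Affine maps of the line are understood to be non-degenerate (invertible);
  constant maps are not included.\<close>
definition affine_map :: "(real \<Rightarrow> real) \<Rightarrow> bool" where
  "affine_map g \<longleftrightarrow> (\<exists>a b. a \<noteq> 0 \<and> g = (\<lambda>x. a * x + b))"

end

theory Submission
  imports Defs
begin

text \<open>
  Write r for the contraction ratio 1/\<beta> and m for 2/(\<beta>-1). The convex hull of E is [0, 1+m].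
  The set splits into F, its part in [0, m], and its part in [1+r, 1+m]. The first is
  f_0(E) \<union> f_1(E), the second is f_{\<beta>+1}(E), which is also 1 + f_1(E). The interval
  G = (m, 1+r) between them is the longest gap of E, and every gap of E lies in the image of G
  under some word. The maps f_0 f_{\<beta>+1} and f_1 f_1 coincide, so f_0(E) and f_1(E) overlap;
  all the difficulty comes from there.

  It suffices that an affine self-embedding g of E other than the identity maps E into one
  first-level piece f_d(E). For then the inverse of f_d composed with g is a self-embedding whose
  ratio is \<beta> times larger; since no self-embedding has a ratio above 1 in modulus, stripping
  letters in this way ends, and it can only end at the identity. This is
  embedding_is_word, resting on inside_first_level.

  The main tool is the comparison of gaps. If g has ratio a and g(E) has points on both sides of a
  gap of E, then that gap pulls back to a gap of E that is 1/|a| times as long. So g(E) cannot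
  have points on both sides of G, the longest gap, unless g is the identity; hence g(E) lies in
  f_{\<beta>+1}(E) or in F. Suppose g(E) lies in F but neither in f_0(E) nor in f_1(E). A similar
  comparison shows that g(E) does not cross f_1(G). Magnified by \<beta>, the map g becomes an affine
  map h other than the identity that sends E into the union K of F and 1 + F, with points strictly
  on both sides of the junction of the two copies. Such an h does not exist, for reasons that differ in the two
  cases m < 1 and m = 1, that is, \<beta> > 3 and \<beta> = 3.

  If \<beta> > 3, the copies F and 1 + F are separated by the interval (m, 1). It pulls back into the
  image of G under a word w. Replacing h by its composition with the map of w, the two parts F
  and f_{\<beta>+1}(E) of E are mapped to opposite sides of the junction. Near the junction K is
  self-similar up to a widening of the middle gap, so the picture can be magnified until the ratio
  is comparable to 1, where lengths of gaps give a contradiction: left_part_rigid if h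
  preserves orientation, no_reflected_placement if h reverses it.

  If \<beta> = 3, the copies touch and there is no middle gap to pull back, but K is exactly
  self-similar at the junction. Magnification by a power of 3 brings the ratio into [1, 3), and
  now each of a few explicit gaps of the magnified set, if crossed, must lie in the image of one of
  the few longest gaps of E. These are finitely many linear conditions on h, and they are
  inconsistent: no_crossing_touching.
\<close>

section \<open>The attractor\<close>

locale overlapping_ifs =
  fixes \<beta> :: real and E :: "real set"
  assumes beta_ge: "\<beta> \<ge> 3"
    and attractor: "self_similar_set (fmap \<beta> ` Omega \<beta>) E"
begin

definition r :: real where "r = 1 / \<beta>"

text \<open>
  The right end of F = E \<inter> [0, m] is m, and the convex hull of E is [0, 1+m].
\<close>
definition m :: real where "m = 2 / (\<beta> - 1)"

lemma r_pos: "0 < r" and r_le: "r \<le> 1/3"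
  using beta_ge by (auto simp: r_def field_simps)

lemma m_le: "m \<le> 1"
  using beta_ge by (simp add: m_def)

text \<open>
  The point m is the image of the right end 1+m under f_1. As a rewrite rule this turns every product
  of m with a power of r into m minus a polynomial in r, which brings the estimates below within
  linear arithmetic.
\<close>
lemma rm: "r * m = m - 2 * r"
  using beta_ge by (simp add: m_def r_def field_simps)

lemma rrm: "r * (r * m) = m - 2 * r - 2 * r\<^sup>2"
  by (simp add: rm right_diff_distrib power2_eq_square)

lemma m_bounds: "2 * r < m" "0 < m"
proof -
  have "0 < m" using beta_ge by (simp add: m_def)
  then show "0 < m" "2 * r < m" using rm r_pos mult_pos_pos[of r m] by auto
qed

lemma r2_le: "r\<^sup>2 \<le> r / 3" and r2_pos: "0 < r\<^sup>2"
  using r_pos r_le mult_left_mono[of r "1/3" r] by (auto simp: power2_eq_square)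

lemma r3_le: "r^3 \<le> r\<^sup>2 / 3" and r3_pos: "0 < r^3"
  using r_pos r_le mult_left_mono[of r "1/3" "r\<^sup>2"]
  by (auto simp: power2_eq_square power3_eq_cube)

lemma fmap_simps:
  "fmap \<beta> 0 x = r * x" "fmap \<beta> 1 x = r * (x + 1)" "fmap \<beta> (\<beta> + 1) x = r * x + 1 + r"
  using beta_ge by (auto simp: fmap_def r_def field_simps)

lemma E_iff: "x \<in> E \<longleftrightarrow> (\<exists>y\<in>E. x = r * y \<or> x = r * (y + 1) \<or> x = r * y + 1 + r)"
proof -
  have "E = (\<Union>\<phi>\<in>fmap \<beta> ` Omega \<beta>. \<phi> ` E)"
    using attractor unfolding self_similar_set_def by blast
  then have "x \<in> E \<longleftrightarrow> x \<in> (\<Union>\<phi>\<in>fmap \<beta> ` Omega \<beta>. \<phi> ` E)" by simp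
  then show ?thesis by (auto simp: Omega_def fmap_simps image_iff)
qed

lemma E_f0: "y \<in> E \<Longrightarrow> r * y \<in> E"
  and E_f1: "y \<in> E \<Longrightarrow> r * (y + 1) \<in> E"
  and E_f2: "y \<in> E \<Longrightarrow> r * y + 1 + r \<in> E"
  using E_iff by blast+

lemma E_ends: "0 \<in> E" "1 + m \<in> E" and E_bounds: "x \<in> E \<Longrightarrow> 0 \<le> x" "x \<in> E \<Longrightarrow> x \<le> 1 + m"
proof -
  have ne: "E \<noteq> {}" and co: "compact E" using attractor unfolding self_similar_set_def by auto
  obtain lo where lo: "lo \<in> E" "\<forall>x\<in>E. lo \<le> x" using compact_attains_inf[OF co ne] by auto
  obtain hi where hi: "hi \<in> E" "\<forall>x\<in>E. x \<le> hi" using compact_attains_sup[OF co ne] by auto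
  obtain y where y: "y \<in> E" "lo = r * y \<or> lo = r * (y + 1) \<or> lo = r * y + 1 + r"
    using lo E_iff by blast
  \<comment> \<open>The least element is fixed by f_0, the greatest one by the last map.\<close>
  have "r * lo \<le> r * y" using lo y r_pos by simp
  moreover have "r * y \<le> lo" using y r_pos by (auto simp: algebra_simps)
  ultimately have "r * lo \<le> lo" by simp
  moreover have "lo \<le> r * lo" using lo E_f0 by blast
  ultimately have "(1 - r) * lo = 0" by (simp add: algebra_simps)
  then have l0: "lo = 0" using r_le by auto
  obtain z where z: "z \<in> E" "hi = r * z \<or> hi = r * (z + 1) \<or> hi = r * z + 1 + r"
    using hi E_iff by blast
  have "r * z \<le> r * hi" using hi z r_pos by simp
  moreover have "hi \<le> r * z + 1 + r" using z r_pos by (auto simp: algebra_simps)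
  ultimately have "hi \<le> r * hi + 1 + r" by simp
  moreover have "r * hi + 1 + r \<le> hi" using hi E_f2 by blast
  ultimately have "(1 - r) * (hi - (1 + m)) = 0" using rm by (simp add: algebra_simps)
  then have h1: "hi = 1 + m" using r_le by auto
  show "0 \<in> E" "1 + m \<in> E" "x \<in> E \<Longrightarrow> 0 \<le> x" "x \<in> E \<Longrightarrow> x \<le> 1 + m"
    using lo hi l0 h1 by auto
qed

lemma E_points: "m \<in> E" "1 + r \<in> E" "r \<in> E"
  using E_f1[OF E_ends(2)] E_f2[OF E_ends(1)] E_f1[OF E_ends(1)] rm
  by (simp_all add: algebra_simps)

lemma E_right: "x \<in> E \<Longrightarrow> m < x \<Longrightarrow> 1 + r \<le> x \<and> (x - 1 - r) / r \<in> E"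
proof -
  assume "x \<in> E" "m < x"
  then obtain y where y: "y \<in> E" "x = r * y \<or> x = r * (y + 1) \<or> x = r * y + 1 + r"
    using E_iff by blast
  have "r * y \<le> r * (1 + m)" "0 \<le> r * y" using E_bounds[OF y(1)] r_pos by auto
  then have "x = r * y + 1 + r" "0 \<le> r * y"
    using y(2) \<open>m < x\<close> rm m_bounds r_pos by (auto simp: algebra_simps)
  then show ?thesis using y(1) r_pos by auto
qed

lemma E_split: "x \<in> E \<Longrightarrow> x \<le> m \<or> 1 + r \<le> x"
  using E_right by fastforce

text \<open>
  The last piece is a translate of the second one, because f_{\<beta>+1}(x) = 1 + f_1(x).
\<close>
lemma E_right_minus_1: "x \<in> E \<Longrightarrow> 1 + r \<le> x \<Longrightarrow> x - 1 \<in> E \<and> r \<le> x - 1 \<and> x - 1 \<le> m"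
proof -
  assume x: "x \<in> E" "1 + r \<le> x"
  then have "(x - 1 - r) / r \<in> E" using E_right m_le r_pos by simp
  then have "r * ((x - 1 - r) / r + 1) \<in> E" using E_f1 by blast
  moreover have "r * ((x - 1 - r) / r + 1) = x - 1" using r_pos by (simp add: field_simps)
  ultimately show ?thesis using x E_bounds(2)[of x] by simp
qed

text \<open>
  Points of the last two pieces are at least r, so a smaller point comes from f_0, and its
  preimage is below 1.
\<close>
lemma E_low: "x \<in> E \<Longrightarrow> x < r \<Longrightarrow> x / r \<in> E \<and> x / r \<le> m"
proof -
  assume x: "x \<in> E" "x < r"
  then obtain y where y: "y \<in> E" "x = r * y \<or> x = r * (y + 1) \<or> x = r * y + 1 + r"
    using E_iff by blast
  have "0 \<le> r * y" using E_bounds[OF y(1)] r_pos by auto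
  then have "x = r * y" using y(2) x r_le by (auto simp: algebra_simps)
  moreover then have "y < 1" using x r_pos by simp
  ultimately show ?thesis using y E_split[of y] r_pos by fastforce
qed

text \<open>
  Here the overlap is used: a point f_0(y) that is at least r has y \<ge> 1, and then y lies in the
  last piece 1 + f_1(E), so that the point also lies in f_1(E).
\<close>
lemma E_middle: "x \<in> E \<Longrightarrow> r \<le> x \<Longrightarrow> x \<le> m \<Longrightarrow> x / r - 1 \<in> E"
proof -
  assume x: "x \<in> E" "r \<le> x" "x \<le> m"
  then obtain y where y: "y \<in> E" "x = r * y \<or> x = r * (y + 1) \<or> x = r * y + 1 + r"
    using E_iff by blast
  have "0 \<le> r * y" using E_bounds[OF y(1)] r_pos by auto
  then consider "x = r * y" | "x = r * (y + 1)" using y(2) x m_le r_pos by fastforce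
  then show ?thesis
  proof cases
    case 1
    then have "1 \<le> y" using x r_pos by simp
    \<comment> \<open>For \<beta> = 3 the value y = 1 is possible, being the right end m of the left part.\<close>
    have "y - 1 \<in> E"
    proof (cases "1 + r \<le> y")
      case True
      then show ?thesis using E_right_minus_1 y by blast
    next
      case False
      then have "y = 1" using E_split[OF y(1)] m_le \<open>1 \<le> y\<close> by auto
      then show ?thesis using E_ends by simp
    qed
    then show ?thesis using 1 r_pos by simp
  next
    case 2
    then show ?thesis using y r_pos by simp
  qed
qed

lemma r_2r: "r * (2 + r) = 2 * r + r\<^sup>2"
  by (simp add: algebra_simps power2_eq_square)

text \<open>
  The image of the main gap under f_1 meets no other piece of E, so it is free of E. The same holds
  for its image under f_0. By contrast, the image of the main gap under f_0 itself is not free of E: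
  it contains r + r^3 = f_1 f_0 f_1(0).
\<close>
lemma E_gap1: "x \<in> E \<Longrightarrow> x \<le> r * (1 + m) \<or> r * (2 + r) \<le> x"
proof -
  assume x: "x \<in> E"
  have "r * (2 + r) \<le> 1 + r" unfolding r_2r using r_le r2_le r_pos by linarith
  moreover have "r \<le> r * (1 + m)" using r_pos m_bounds by simp
  moreover have ?thesis if "r \<le> x" "x \<le> m"
  proof -
    have "x / r - 1 \<le> m \<or> 1 + r \<le> x / r - 1" using E_middle[OF x that] E_split by blast
    then show ?thesis using r_pos by (auto simp: field_simps)
  qed
  ultimately show ?thesis using E_split[OF x] by linarith
qed

lemma E_gap01: "x \<in> E \<Longrightarrow> x \<le> r * (r * (1 + m)) \<or> r * (r * (2 + r)) \<le> x"
proof -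
  assume x: "x \<in> E"
  show ?thesis
  proof (cases "x < r")
    case True
    then show ?thesis using E_gap1[of "x / r"] E_low[OF x True] r_pos by (auto simp: field_simps)
  next
    case False
    have "r * (2 + r) \<le> 1" unfolding r_2r using r_le r2_le r_pos by linarith
    then have "r * (r * (2 + r)) \<le> r * 1" using r_pos by (intro mult_left_mono) auto
    then show ?thesis using False by auto
  qed
qed

text \<open>
  The part of F to the right of the gap f_1(G) is f_1 f_{\<beta>+1}(E) = f_1(1 + f_1(E)), a small copy
  of f_1(E).
\<close>
lemma E_top: "x \<in> E \<Longrightarrow> r * (2 + r) \<le> x \<Longrightarrow> x \<le> m \<Longrightarrow>
    x / r - 2 \<in> E \<and> r \<le> x / r - 2 \<and> x / r - 2 \<le> m"
proof -
  assume x: "x \<in> E" "r * (2 + r) \<le> x" "x \<le> m"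
  have "r \<le> r * (2 + r)" using r_pos by (simp add: algebra_simps)
  then have "x / r - 1 \<in> E" using E_middle x by simp
  moreover have "1 + r \<le> x / r - 1" using x r_pos by (simp add: field_simps)
  ultimately show ?thesis using E_right_minus_1[of "x / r - 1"] by (auto simp: algebra_simps)
qed

section \<open>Gaps of the attractor\<close>

text \<open>
  An open interval inside the convex hull that is free of E. It need not be maximal, so that any
  subinterval found to be free can be compared with the long gaps.
\<close>
definition gap :: "real \<Rightarrow> real \<Rightarrow> bool" where
  "gap u v \<longleftrightarrow> 0 \<le> u \<and> u < v \<and> v \<le> 1 + m \<and> (\<forall>x\<in>E. x \<le> u \<or> v \<le> x)"

lemma gap_point: "gap u v \<Longrightarrow> x \<in> E \<Longrightarrow> x \<le> u \<or> v \<le> x"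
  by (auto simp: gap_def)

lemma gap_pullback:
  assumes "gap u v" "0 < s" "\<And>x. x \<in> E \<Longrightarrow> s * x + c \<in> E" "c \<le> u" "v \<le> s * (1 + m) + c"
  shows "gap ((u - c) / s) ((v - c) / s)"
proof -
  have "x \<le> (u - c) / s \<or> (v - c) / s \<le> x" if "x \<in> E" for x
    using gap_point[OF assms(1) assms(3)[OF that]] assms(2) by (auto simp: field_simps)
  then show ?thesis using assms by (auto simp: gap_def field_simps)
qed

text \<open>
  The points r, m and 1+r of E confine a gap to the main gap or to the hull of one first-level
  piece, and magnifying that piece gives a longer gap. In the overlap of the hulls of the first two
  pieces the point r decides which of them is used.
\<close>
lemma gap_step:
  assumes "gap u v"
  obtains "m \<le> u" "v \<le> 1 + r"
  | "v \<le> r" "gap (u / r) (v / r)"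
  | "r \<le> u" "v \<le> m" "gap ((u - r) / r) ((v - r) / r)"
  | "1 + r \<le> u" "gap ((u - (1 + r)) / r) ((v - (1 + r)) / r)"
proof -
  have u: "0 \<le> u" "v \<le> 1 + m" "u < v" using assms by (auto simp: gap_def)
  have e: "r * (1 + m) + r = m" "r * (1 + m) + (1 + r) = 1 + m" "v \<le> r \<Longrightarrow> v \<le> r * (1 + m)"
    using rm m_bounds r_pos by (auto simp: algebra_simps)
  consider "m \<le> u" "v \<le> 1 + r" | "v \<le> r" | "r \<le> u" "v \<le> m" | "1 + r \<le> u"
    using gap_point[OF assms E_points(1)] gap_point[OF assms E_points(2)]
      gap_point[OF assms E_points(3)] by blast
  then show thesis
  proof cases
    case 1 then show ?thesis by (rule that(1))
  next
    case 2
    have "gap ((u - 0) / r) ((v - 0) / r)"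
      using assms r_pos E_f0 u 2 e(3) by (intro gap_pullback) auto
    then show ?thesis using 2 that(2) by simp
  next
    case 3
    have "gap ((u - r) / r) ((v - r) / r)"
      using assms r_pos E_f1 u 3 e(1) by (intro gap_pullback) (auto simp: algebra_simps)
    then show ?thesis using 3 that(3) by simp
  next
    case 4
    have "gap ((u - (1 + r)) / r) ((v - (1 + r)) / r)"
      using assms r_pos E_f2 u 4 e(2) by (intro gap_pullback) (auto simp: algebra_simps)
    then show ?thesis using 4 that(4) by simp
  qed
qed

text \<open>
  The similarities of positive ratio that are used to zoom into E; the maps of words are
  among them. Ratio 1 only occurs for the empty word.
\<close>
definition cylinder :: "real \<Rightarrow> real \<Rightarrow> bool" where
  "cylinder s c \<longleftrightarrow> 0 < s \<and> s \<le> 1 \<and> (s = 1 \<longrightarrow> c = 0) \<and> (\<forall>x\<in>E. s * x + c \<in> E)"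

lemma cylinder_step:
  assumes "cylinder s c" "e = 0 \<or> e = r \<or> e = 1 + r"
  shows "cylinder (r * s) (r * c + e)"
proof -
  have "r * (s * x + c) + e \<in> E" if "x \<in> E" for x
  proof -
    have "s * x + c \<in> E" using assms(1) that by (simp add: cylinder_def)
    then show ?thesis using E_f0[of "s * x + c"] E_f1[of "s * x + c"] E_f2[of "s * x + c"] assms(2)
      by (auto simp: algebra_simps)
  qed
  moreover have "r * s \<le> r * 1" using assms(1) r_pos unfolding cylinder_def
    by (intro mult_left_mono) auto
  moreover have "0 < r * s" using assms(1) r_pos by (simp add: cylinder_def)
  ultimately show ?thesis using r_le by (auto simp: cylinder_def algebra_simps)
qed

text \<open>
  Magnifying a gap makes it longer by the factor 1/r at each step, which cannot go on inside the
  bounded set; so the descent ends in the main gap.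
\<close>
lemma gap_in_cylinder:
  assumes "gap u v"
  obtains s c where "cylinder s c" "s * m + c \<le> u" "v \<le> s * (1 + r) + c"
proof -
  \<comment> \<open>After n magnifications the gap would be longer than the hull of E.\<close>
  obtain n where n: "(1 + m) * r ^ n < v - u"
  proof -
    have "0 < (v - u) / (1 + m)" using assms m_bounds by (simp add: gap_def)
    then obtain n where "r ^ n < (v - u) / (1 + m)"
      using real_arch_pow_inv[of _ r] r_le by auto
    then show thesis using that[of n] m_bounds by (simp add: field_simps)
  qed
  have "\<exists>s c. cylinder s c \<and> s * m + c \<le> u \<and> v \<le> s * (1 + r) + c"
    using assms n
  proof (induction n arbitrary: u v)
    case 0
    then show ?case by (auto simp: gap_def)
  next
    case (Suc n)
    have base: "cylinder 1 0" by (simp add: cylinder_def)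
    have step: "\<exists>s c. cylinder s c \<and> s * m + c \<le> u \<and> v \<le> s * (1 + r) + c"
      if e: "e = 0 \<or> e = r \<or> e = 1 + r" and g: "gap ((u - e) / r) ((v - e) / r)" for e
    proof -
      have "(v - e) / r - (u - e) / r = (v - u) / r" by (simp add: diff_divide_distrib)
      moreover have "(1 + m) * r ^ n < (v - u) / r" using Suc.prems(2) r_pos
        by (simp add: field_simps)
      ultimately obtain s c where sc: "cylinder s c" "s * m + c \<le> (u - e) / r"
          "(v - e) / r \<le> s * (1 + r) + c"
        using Suc.IH[OF g] by auto
      have "r * s * m + (r * c + e) \<le> u" "v \<le> r * s * (1 + r) + (r * c + e)"
        using sc r_pos by (auto simp: field_simps)
      then show ?thesis using cylinder_step[OF sc(1) e] by blast
    qed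
    from Suc.prems(1) show ?case
    proof (cases rule: gap_step)
      case 1
      then show ?thesis using base by fastforce
    next
      case 2
      then show ?thesis using step[of 0] by simp
    next
      case 3
      then show ?thesis using step[of r] by blast
    next
      case 4
      then show ?thesis using step[of "1 + r"] by blast
    qed
  qed
  then show thesis using that by blast
qed

lemma gap_length: "gap u v \<Longrightarrow> v - u \<le> 1 + r - m"
proof -
  assume "gap u v"
  then obtain s c where "cylinder s c" "s * m + c \<le> u" "v \<le> s * (1 + r) + c"
    by (rule gap_in_cylinder)
  then have "v - u \<le> s * (1 + r - m)" "s \<le> 1" by (auto simp: algebra_simps cylinder_def)
  moreover have "s * (1 + r - m) \<le> 1 * (1 + r - m)"
    using \<open>s \<le> 1\<close> m_le r_pos by (intro mult_right_mono) auto
  ultimately show ?thesis by simp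
qed

text \<open>
  A gap outside the main gap becomes a gap after a magnification by 1/r, hence is shorter than
  the main gap by the factor r.
\<close>
lemma gap_length_left: "gap u v \<Longrightarrow> v \<le> m \<Longrightarrow> v - u \<le> r * (1 + r - m)"
  and gap_length_right: "gap u v \<Longrightarrow> 1 + r \<le> u \<Longrightarrow> v - u \<le> r * (1 + r - m)"
  and large_gap: "gap u v \<Longrightarrow> r * (1 + r - m) < v - u \<Longrightarrow> m \<le> u \<and> v \<le> 1 + r"
proof -
  have *: "v - u \<le> r * (1 + r - m) \<or> (m \<le> u \<and> v \<le> 1 + r)" if "gap u v" for u v
  proof -
    have d: "v - u \<le> r * (1 + r - m)" if "gap ((u - e) / r) ((v - e) / r)" for e
      using gap_length[OF that] r_pos by (auto simp: field_simps)
    from \<open>gap u v\<close> show ?thesis by (cases rule: gap_step) (use d d[of 0] in auto)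
  qed
  show "gap u v \<Longrightarrow> v \<le> m \<Longrightarrow> v - u \<le> r * (1 + r - m)"
    and "gap u v \<Longrightarrow> 1 + r \<le> u \<Longrightarrow> v - u \<le> r * (1 + r - m)"
    and "gap u v \<Longrightarrow> r * (1 + r - m) < v - u \<Longrightarrow> m \<le> u \<and> v \<le> 1 + r"
    using *[of u v] by (auto simp: gap_def)
qed

text \<open>
  Comparison of gaps: an interval (p, q) that the image of E avoids and crosses pulls back to a
  gap of E. The points x1 and x2 limit the part of E that is involved, and so the place of the
  gap.
\<close>
lemma crossing_pos:
  assumes "0 < a" "x1 \<in> E" "x2 \<in> E" "a * x1 + b \<le> p" "q \<le> a * x2 + b" "p < q"
    and avoid: "\<And>x. x \<in> E \<Longrightarrow> x1 \<le> x \<Longrightarrow> x \<le> x2 \<Longrightarrow> a * x + b \<le> p \<or> q \<le> a * x + b"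
  obtains u v where "gap u v" "x1 \<le> u" "v \<le> x2" "a * u + b = p" "a * v + b = q"
proof -
  define u v where uv: "u = (p - b) / a" "v = (q - b) / a"
  have e: "a * u + b = p" "a * v + b = q" using assms(1) by (auto simp: uv)
  have 1: "x1 \<le> u" "v \<le> x2" "u < v" using assms by (auto simp: uv field_simps)
  have "x \<le> u \<or> v \<le> x" if "x \<in> E" for x
  proof (cases "x1 \<le> x \<and> x \<le> x2")
    case True
    then show ?thesis using avoid[OF that] assms(1) by (auto simp: uv field_simps)
  next
    case False
    then show ?thesis using 1 by auto
  qed
  then have "gap u v" using 1 E_bounds[OF assms(2)] E_bounds[OF assms(3)]
    by (auto simp: gap_def)
  then show thesis using that 1 e by blast
qed

lemma crossing_neg:
  assumes "a < 0" "x1 \<in> E" "x2 \<in> E" "q \<le> a * x1 + b" "a * x2 + b \<le> p" "p < q"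
    and avoid: "\<And>x. x \<in> E \<Longrightarrow> x1 \<le> x \<Longrightarrow> x \<le> x2 \<Longrightarrow> a * x + b \<le> p \<or> q \<le> a * x + b"
  obtains u v where "gap u v" "x1 \<le> u" "v \<le> x2" "a * u + b = q" "a * v + b = p"
proof -
  have avoid': "- a * x + - b \<le> - q \<or> - p \<le> - a * x + - b"
    if "x \<in> E" "x1 \<le> x" "x \<le> x2" for x
    using avoid[OF that] by linarith
  have "0 < - a" "- a * x1 + - b \<le> - q" "- p \<le> - a * x2 + - b" "- q < - p"
    using assms(1,4-6) by auto
  then obtain u v where uv: "gap u v" "x1 \<le> u" "v \<le> x2"
      "- a * u + - b = - q" "- a * v + - b = - p"
    using crossing_pos[of "- a" x1 x2 "- b" "- q" "- p"] assms(2,3) avoid' by metis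
  show thesis by (rule that[OF uv(1-3)]) (use uv(4,5) in linarith)+
qed

section \<open>A map that separates the two parts of the attractor\<close>

lemma r_1m: "r * (1 + m) = m - r"
  using rm by (simp add: algebra_simps)

lemma power_below:
  assumes "0 < a"
  obtains n where "r ^ n \<le> a"
  using real_arch_pow_inv[of a r] assms r_le less_imp_le by fastforce

text \<open>
  The reflection of F in its midpoint does not preserve F. The reflected point is the right end
  of the gap f_0 f_1(G), and its mirror image falls into the gap f_1(G).
\<close>
lemma reflected_point: "m - r * (r * (2 + r)) \<notin> E"
proof
  assume *: "m - r * (r * (2 + r)) \<in> E"
  have y: "r * (2 * r + r\<^sup>2) = 2 * r\<^sup>2 + r^3"
    by (simp add: algebra_simps power2_eq_square power3_eq_cube)
  have "r * (r * m) \<le> r * (r * 1)" using m_le r_pos by (intro mult_left_mono) auto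
  then have "m - 2 * r - 2 * r\<^sup>2 \<le> r\<^sup>2" unfolding rrm by (simp add: power2_eq_square)
  moreover have "m - (2 * r\<^sup>2 + r^3) \<le> m - r \<or> 2 * r + r\<^sup>2 \<le> m - (2 * r\<^sup>2 + r^3)"
    using E_gap1[OF *] unfolding r_1m r_2r y .
  ultimately show False using r3_le r3_pos r2_le r_pos by linarith
qed

lemma main_gap_pos: "0 < 1 + r - m"
  using m_le r_pos by simp

lemma r_gap: "r * (1 + r - m) = r * (2 + r) - r * (1 + m)"
  by (simp add: algebra_simps)

lemma no_large_crossing:
  assumes "a * (v - u) = r * (1 + r - m)" "v - u \<le> r * (1 + r - m)" "0 < a" "a < 1"
  shows False
proof -
  have g: "0 < r * (1 + r - m)" using r_pos main_gap_pos by simp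
  have "a * (v - u) \<le> a * (r * (1 + r - m))" using assms(2,3) by (intro mult_left_mono) auto
  also have "\<dots> < 1 * (r * (1 + r - m))" using g assms by (intro mult_strict_right_mono)
  finally show False using assms(1) by linarith
qed

text \<open>
  An affine map that preserves orientation, maps F into itself and moves 1+r, the first point of E
  after the main gap, to the right of the junction 1, is the identity. If the ratio a is below 1,
  then the image of F does not cross the gap f_1(G). If it lies to the left of f_1(G), the image of
  the main gap is at least as long as the main gap. So it lies to the right of f_1(G), in a small
  copy of f_1(E), and this copy can be magnified to F; the hypotheses persist and the ratio
  grows by the factor 1/r.
\<close>
lemma left_part_rigid:
  assumes "0 < a" "\<And>x. x \<in> E \<Longrightarrow> x \<le> m \<Longrightarrow> a * x + b \<in> E \<and> a * x + b \<le> m"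
    and "1 \<le> a * (1 + r) + b"
  shows "a = 1 \<and> b = 0"
proof -
  obtain n where "r ^ n \<le> a" using power_below assms(1) by blast
  then show ?thesis using assms
  proof (induction n arbitrary: a b)
    case (0 a b)
    have "0 \<le> b" "a * m + b \<le> m"
      using "0.prems"(3)[of 0] "0.prems"(3)[of m] E_ends E_points m_bounds E_bounds by auto
    moreover have "1 * m \<le> a * m" using "0.prems"(1) m_bounds by (intro mult_right_mono) auto
    ultimately have "b = 0" "a * m = 1 * m" by linarith+
    then show ?case using m_bounds by simp
  next
    case (Suc n a b)
    have h0: "b \<in> E" "b \<le> m" and hm: "a * m + b \<in> E" "a * m + b \<le> m"
      using Suc.prems(3)[of 0] Suc.prems(3)[of m] E_ends E_points m_bounds by auto
    show ?case
    proof (cases "a < 1")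
      case True
      have "\<not> (a * m + b \<le> r * (1 + m))"
      proof
        assume "a * m + b \<le> r * (1 + m)"
        then have "1 * (1 + r - m) \<le> a * (1 + r - m)"
          using Suc.prems(4) r_1m by (simp add: algebra_simps)
        then show False using True main_gap_pos by simp
      qed
      moreover have "\<not> (b \<le> r * (1 + m) \<and> r * (2 + r) \<le> a * m + b)"
      proof
        assume *: "b \<le> r * (1 + m) \<and> r * (2 + r) \<le> a * m + b"
        have "r * (1 + m) < r * (2 + r)" using r_gap r_pos main_gap_pos
          by (simp add: mult_strict_left_mono)
        then obtain u v where uv: "gap u v" "v \<le> m" "a * u + b = r * (1 + m)"
            "a * v + b = r * (2 + r)"
          using crossing_pos[of a 0 m b "r * (1 + m)" "r * (2 + r)"] Suc.prems(2,3) *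
            E_ends E_points E_gap1 by (metis add_0 mult_zero_right)
        have "a * (v - u) = r * (1 + r - m)" using uv(3,4) r_gap by (simp add: algebra_simps)
        then show False using no_large_crossing gap_length_left uv Suc.prems(2) True by blast
      qed
      ultimately have b: "r * (2 + r) \<le> b" using E_gap1[OF h0(1)] E_gap1[OF hm(1)] by blast
      have z: "a / r * x + (b / r - 2) \<in> E \<and> r \<le> a / r * x + (b / r - 2) \<and>
            a / r * x + (b / r - 2) \<le> m"
        if "x \<in> E" "x \<le> m" for x
      proof -
        have "0 \<le> a * x" using Suc.prems(2) E_bounds that by simp
        then have "r * (2 + r) \<le> a * x + b" using b by simp
        then show ?thesis using E_top[of "a * x + b"] Suc.prems(3)[OF that]
          by (simp add: add_divide_distrib algebra_simps)
      qed
      have "3 \<le> 1 / r" using r_pos r_le by (simp add: field_simps)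
      moreover have "a / r * (1 + r) + (b / r - 2) = (a * (1 + r) + b) / r - 2"
        using r_pos by (simp add: field_simps)
      moreover have "1 / r \<le> (a * (1 + r) + b) / r" using Suc.prems(4) r_pos
        by (intro divide_right_mono) auto
      ultimately have "1 \<le> a / r * (1 + r) + (b / r - 2)" by simp
      moreover have "r ^ n \<le> a / r" "0 < a / r" using Suc.prems r_pos by (auto simp: field_simps)
      ultimately have "a / r = 1 \<and> b / r - 2 = 0" using Suc.IH z by blast
      moreover have "r \<le> b / r - 2" using z[of 0] E_ends(1) m_bounds(2) by simp
      ultimately show ?thesis using r_pos by linarith
    next
      case False
      have "0 \<le> b" using h0 E_bounds by auto
      moreover have "1 * m \<le> a * m" using False m_bounds by (intro mult_right_mono) auto
      ultimately have "b = 0" "a * m = 1 * m" using hm(2) by linarith+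
      then show ?thesis using m_bounds by simp
    qed
  qed
qed

text \<open>
  In F there are gaps whose length is that of f_1(G), the longest possible one. They lie to the
  right of f_1 of the hull [0, m]: a gap in the hull of f_0(E) ends before r and is therefore
  shorter.
\<close>
lemma critical_left_gap:
  assumes "gap u v" "v \<le> m" "r * (1 + r - m) \<le> v - u"
  shows "r * (1 + m) \<le> u"
proof -
  have g: "r * (1 + r - m) < 1 * (1 + r - m)"
    using main_gap_pos r_le by (intro mult_strict_right_mono) auto
  have "1 + r - m \<le> (v - u) / r" using assms(3) r_pos by (simp add: field_simps)
  then have len: "r * (1 + r - m) < (v - e) / r - (u - e) / r" for e
    using g by (simp add: diff_divide_distrib)
  have main: "m \<le> (u - e) / r" "(v - e) / r \<le> 1 + r" if "gap ((u - e) / r) ((v - e) / r)" for e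
    using large_gap[OF that len] by auto
  from assms(1) show ?thesis
  proof (cases rule: gap_step)
    case 1
    then show ?thesis using assms by (simp add: gap_def)
  next
    case 2
    have "m \<le> u / r" using main[of 0] 2 by simp
    moreover have "v / r \<le> 1" using 2 r_pos by simp
    moreover have "1 + r - m \<le> v / r - u / r"
      using assms(3) r_pos by (simp add: field_simps)
    ultimately have False using r_pos by linarith
    then show ?thesis ..
  next
    case 3
    then show ?thesis using main(1)[of r] r_pos by (simp add: field_simps)
  next
    case 4
    then show ?thesis using assms m_le r_pos by (simp add: gap_def)
  qed
qed

text \<open>
  The counterpart for maps x \<mapsto> b - a x that reverse orientation: F cannot be mapped into 1 + F
  while f_{\<beta>+1}(E) is mapped into c + F with c \<le> 0. The shift c is there because magnification
  about 1 widens the space between the two target copies, so that the statement is kept by the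
  magnification only if this space is arbitrary.

  If a < 1, neither image crosses the translate of f_1(G) in its target. Since the image of the
  main gap is shorter than the main gap, the image of F must be on the left of that gap and the
  image of f_{\<beta>+1}(E) on the right of it; the latter gives a \<le> r. If F is mapped into
  1 + f_0(F), magnify. Otherwise the image of F crosses 1 + f_0 f_1(G), which forces a = r and pulls
  this gap back to f_1(G); but then the image of the main gap is too short to reach the left copy.
\<close>
lemma no_reflected_placement:
  assumes "0 < a" "c \<le> 0"
    and "\<And>x. x \<in> E \<Longrightarrow> x \<le> m \<Longrightarrow> b - a * x - 1 \<in> E \<and> b - a * x - 1 \<le> m"
    and "\<And>x. x \<in> E \<Longrightarrow> 1 + r \<le> x \<Longrightarrow> b - a * x - c \<in> E \<and> b - a * x - c \<le> m"
  shows False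
proof -
  obtain n where "r ^ n \<le> a" using power_below assms(1) by blast
  then show ?thesis using assms
  proof (induction n arbitrary: a b c)
    case (0 a b c)
    have "b \<le> 1 + m" "1 \<le> b - a * m"
      using "0.prems"(4)[of 0] "0.prems"(4)[of m] E_ends(1) E_points(1) m_bounds
        E_bounds(1)[of "b - a * m - 1"] by auto
    moreover have "1 * m \<le> a * m" using "0.prems"(1) m_bounds by (intro mult_right_mono) auto
    ultimately have "a * m = 1 * m" "b = 1 + m" by linarith+
    then have ab: "a = 1" "b = 1 + m" using m_bounds by auto
    have y: "r * (r * (2 + r)) \<in> E"
      using E_f0[OF E_f1[OF E_points(2)]] by (simp add: algebra_simps)
    have "r * (2 + r) \<le> 1" unfolding r_2r using r_pos r_le r2_le by linarith
    then have "r * (r * (2 + r)) \<le> r * 1" using r_pos by (intro mult_left_mono) auto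
    then have "r * (r * (2 + r)) \<le> m" using m_bounds r_pos by linarith
    then show ?case using "0.prems"(4)[OF y] reflected_point ab by simp
  next
    case (Suc n a b c)
    note F = Suc.prems(4) and P = Suc.prems(5)
    have h0: "b - 1 \<in> E" "b - 1 \<le> m" and hm: "b - a * m - 1 \<in> E" "b - a * m - 1 \<le> m"
      using F[of 0] F[of m] E_ends E_points m_bounds by auto
    have h1: "b - a * (1 + r) - c \<in> E" "b - a * (1 + r) - c \<le> m"
      using P[of "1 + r"] E_points by auto
    have hM: "b - a * (1 + m) - c \<in> E" "b - a * (1 + m) - c \<le> m"
      using P[of "1 + m"] E_ends m_bounds r_pos by auto
    have rg: "r * (1 + m) < r * (2 + r)" using r_gap r_pos main_gap_pos
      by (simp add: mult_strict_left_mono)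
    have gap_img: "a * (1 + r - m) = (b - a * m) - (b - a * (1 + r))" by (simp add: algebra_simps)
    have hm1: "1 \<le> b - a * m" using E_bounds[OF hm(1)] by simp
    show False
    proof (cases "a < 1")
      case False
      moreover have "r ^ n \<le> 1" using r_le r_pos by (simp add: power_le_one)
      ultimately have "r ^ n \<le> a" by simp
      then show False using Suc.IH[of a c b] Suc.prems(2-5) by blast
    next
      case True
      have small: "a * (1 + r - m) < 1 + r - m"
        using True main_gap_pos by simp
      have notF: "\<not> (r * (2 + r) \<le> b - 1 \<and> b - a * m - 1 \<le> r * (1 + m))"
      proof
        assume *: "r * (2 + r) \<le> b - 1 \<and> b - a * m - 1 \<le> r * (1 + m)"
        have avoid: "- a * x + (b - 1) \<le> r * (1 + m) \<or> r * (2 + r) \<le> - a * x + (b - 1)"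
          if "x \<in> E" "x \<le> m" for x
          using E_gap1[of "b - a * x - 1"] F[OF that] by (simp add: algebra_simps)
        have pre: "- a < 0" "r * (2 + r) \<le> - a * 0 + (b - 1)" "- a * m + (b - 1) \<le> r * (1 + m)"
          using Suc.prems(2) * by (auto simp: algebra_simps)
        obtain u v where uv: "gap u v" "v \<le> m" "- a * u + (b - 1) = r * (2 + r)"
            "- a * v + (b - 1) = r * (1 + m)"
          using crossing_neg[OF pre(1) E_ends(1) E_points(1) pre(2,3) rg] avoid by blast
        have "a * (v - u) = r * (1 + r - m)" using uv(3,4) r_gap by (simp add: algebra_simps)
        then show False using no_large_crossing gap_length_left uv Suc.prems(2) True by blast
      qed
      have notP: "\<not> (r * (2 + r) \<le> b - a * (1 + r) - c \<and> b - a * (1 + m) - c \<le> r * (1 + m))"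
      proof
        assume *: "r * (2 + r) \<le> b - a * (1 + r) - c \<and> b - a * (1 + m) - c \<le> r * (1 + m)"
        have avoid: "- a * x + (b - c) \<le> r * (1 + m) \<or> r * (2 + r) \<le> - a * x + (b - c)"
          if "x \<in> E" "1 + r \<le> x" for x
          using E_gap1[of "b - a * x - c"] P[OF that] by (simp add: algebra_simps)
        have pre: "- a < 0" "r * (2 + r) \<le> - a * (1 + r) + (b - c)" "- a * (1 + m) + (b - c) \<le> r * (1 + m)"
          using Suc.prems(2) * by (auto simp: algebra_simps)
        obtain u v where uv: "gap u v" "1 + r \<le> u" "- a * u + (b - c) = r * (2 + r)"
            "- a * v + (b - c) = r * (1 + m)"
          using crossing_neg[OF pre(1) E_points(2) E_ends(2) pre(2,3) rg] avoid by blast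
        have "a * (v - u) = r * (1 + r - m)" using uv(3,4) r_gap by (simp add: algebra_simps)
        then show False using no_large_crossing gap_length_right uv Suc.prems(2) True by blast
      qed
      have "\<not> r * (2 + r) \<le> b - a * m - 1"
      proof
        assume "r * (2 + r) \<le> b - a * m - 1"
        then have "1 + r - m \<le> a * (1 + r - m)"
          using h1(2) Suc.prems(3) r_pos r2_pos unfolding gap_img r_2r by linarith
        then show False using small by simp
      qed
      then have b_le: "b - 1 \<le> r * (1 + m)" "b - a * m - 1 \<le> r * (1 + m)"
        using notF E_gap1[OF hm(1)] E_gap1[OF h0(1)] by auto
      have "\<not> b - a * (1 + r) - c \<le> r * (1 + m)"
      proof
        assume "b - a * (1 + r) - c \<le> r * (1 + m)"
        then have "1 + r - m \<le> a * (1 + r - m)"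
          using hm1 Suc.prems(3) unfolding gap_img r_1m by linarith
        then show False using small by simp
      qed
      then have M_ge: "r * (2 + r) \<le> b - a * (1 + m) - c"
        using notP E_gap1[OF h1(1)] E_gap1[OF hM(1)] by auto
      have "a * (m - r) \<le> r * (m - r)"
      proof -
        have "a * (m - r) = (b - a * (1 + r) - c) - (b - a * (1 + m) - c)"
          by (simp add: algebra_simps)
        also have "\<dots> \<le> m - (2 * r + r\<^sup>2)" using h1(2) M_ge unfolding r_2r by linarith
        also have "\<dots> = r * (m - r)" using rm by (simp add: algebra_simps power2_eq_square)
        finally show ?thesis .
      qed
      then have ar: "a \<le> r" using m_bounds r_pos by simp
      show False
      proof (cases "b < 1 + r")
        case True
        \<comment> \<open>Magnify about 1. In the left copy the magnified target is the part beyond f_1(G).\<close>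
        have "1 / r \<ge> 3" using r_pos r_le by (simp add: field_simps)
        then have c: "(c - 1) / r + 3 \<le> 0"
          using Suc.prems(3) r_pos divide_nonpos_pos[of c r] by (simp add: diff_divide_distrib)
        have F': "(b - 1) / r + 1 - a / r * x - 1 \<in> E \<and> (b - 1) / r + 1 - a / r * x - 1 \<le> m"
          if "x \<in> E" "x \<le> m" for x
        proof -
          have "0 \<le> a * x" using Suc.prems(2) E_bounds that by simp
          then have "b - a * x - 1 < r" using True by simp
          moreover have "(b - 1) / r + 1 - a / r * x - 1 = (b - a * x - 1) / r"
            using r_pos by (simp add: field_simps)
          ultimately show ?thesis using E_low F[OF that] by simp
        qed
        have P': "(b - 1) / r + 1 - a / r * x - ((c - 1) / r + 3) \<in> E \<and>
            (b - 1) / r + 1 - a / r * x - ((c - 1) / r + 3) \<le> m"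
          if "x \<in> E" "1 + r \<le> x" for x
        proof -
          have "a * x \<le> a * (1 + m)" using Suc.prems(2) E_bounds that by simp
          then have "r * (2 + r) \<le> b - a * x - c" using M_ge by simp
          moreover have "(b - 1) / r + 1 - a / r * x - ((c - 1) / r + 3) = (b - a * x - c) / r - 2"
            using r_pos by (simp add: field_simps)
          ultimately show ?thesis using E_top P[OF that] by simp
        qed
        have "r ^ n \<le> a / r" "0 < a / r" using Suc.prems r_pos by (auto simp: field_simps)
        then show False using Suc.IH[OF _ _ c F' P'] by blast
      next
        case False
        have "a * (1 + r - m) \<le> r * (1 + r - m)" using ar main_gap_pos by simp
        also have "r * (1 + r - m) = 3 * r + r\<^sup>2 - m"
          using rm by (simp add: algebra_simps power2_eq_square)
        finally have hm_le: "b - a * m \<le> 3 * r + r\<^sup>2"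
          using h1(2) Suc.prems(3) unfolding gap_img by linarith
        have rr: "r * (r * (1 + m)) = m - 2 * r - r\<^sup>2" "r * (r * (2 + r)) = 2 * r\<^sup>2 + r^3"
          using rrm by (simp_all add: algebra_simps power2_eq_square power3_eq_cube)
        have "0 \<le> r * (r * m)" using r_pos m_bounds by simp
        then have lo: "b - a * m - 1 \<le> r * (r * (1 + m))"
          using hm_le r_le unfolding rr rrm by linarith
        have hi: "r * (r * (2 + r)) \<le> b - 1"
          using False r2_le r3_le r_pos unfolding rr by linarith
        have rrg: "r * (r * (1 + m)) < r * (r * (2 + r))" using rg r_pos by simp
        have avoid: "- a * x + (b - 1) \<le> r * (r * (1 + m)) \<or> r * (r * (2 + r)) \<le> - a * x + (b - 1)"
          if "x \<in> E" "x \<le> m" for x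
          using E_gap01[of "b - a * x - 1"] F[OF that] by (simp add: algebra_simps)
        have pre: "- a < 0" "r * (r * (2 + r)) \<le> - a * 0 + (b - 1)" "- a * m + (b - 1) \<le> r * (r * (1 + m))"
          using Suc.prems(2) lo hi by (auto simp: algebra_simps)
        obtain u v where uv: "gap u v" "v \<le> m" "- a * u + (b - 1) = r * (r * (2 + r))"
            "- a * v + (b - 1) = r * (r * (1 + m))"
          using crossing_neg[OF pre(1) E_ends(1) E_points(1) pre(2,3) rrg] avoid by blast
        have "r * (r * (1 + r - m)) = a * (v - u)"
          using uv(3,4) by (simp add: algebra_simps)
        also have "\<dots> \<le> r * (v - u)" using ar uv(1) by (intro mult_right_mono) (auto simp: gap_def)
        finally have "r * (1 + r - m) \<le> v - u" using r_pos by simp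
        then have u: "m - r \<le> u" using critical_left_gap[OF uv(1,2)] r_1m by simp
        have "a * (m - u) \<le> r * r"
          using ar u uv(1,2) Suc.prems(2) r_pos by (intro mult_mono) (auto simp: gap_def)
        then have "1 + r\<^sup>2 + r^3 \<le> b - a * m"
          using uv(3) unfolding rr by (simp add: algebra_simps power2_eq_square)
        then show False using hm_le r_le r3_pos by linarith
      qed
    qed
  qed
qed

section \<open>No crossing of the junction: separated copies\<close>

definition two_copies :: "real set" where
  "two_copies = {y. y \<in> E \<and> y \<le> m} \<union> {y. y - 1 \<in> E \<and> y - 1 \<le> m}"

lemma two_copies_bounds: "y \<in> two_copies \<Longrightarrow> 0 \<le> y \<and> y \<le> 1 + m"
  using E_bounds(1)[of y] E_bounds(1)[of "y - 1"] by (auto simp: two_copies_def)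

lemma two_copies_low: "y \<in> two_copies \<Longrightarrow> y < 1 \<Longrightarrow> y \<in> E \<and> y \<le> m"
  using E_bounds(1)[of "y - 1"] by (auto simp: two_copies_def)

lemma two_copies_high: "y \<in> two_copies \<Longrightarrow> 1 \<le> y \<Longrightarrow> y - 1 \<in> E \<and> y - 1 \<le> m"
proof -
  assume y: "y \<in> two_copies" "1 \<le> y"
  have "y = 1" if "y \<le> m" using that y(2) m_le by simp
  then show ?thesis using y E_ends(1) m_bounds by (auto simp: two_copies_def)
qed

text \<open>
  Only the end points 0 and 1+m of the hull of E matter for the ratio of a map into an interval of
  the same length.
\<close>
lemma hull_into:
  assumes "0 \<le> b" "b \<le> 1 + m" "0 \<le> a * (1 + m) + b" "a * (1 + m) + b \<le> 1 + m"
  shows "\<bar>a\<bar> \<le> 1" "a = 1 \<Longrightarrow> b = 0" "a = -1 \<Longrightarrow> b = 1 + m"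
proof -
  have M: "0 < 1 + m" using m_bounds by simp
  have "a * (1 + m) \<le> 1 * (1 + m)" "(-1) * (1 + m) \<le> a * (1 + m)" using assms by auto
  then show "\<bar>a\<bar> \<le> 1" using M by (auto simp only: mult_le_cancel_right abs_le_iff)
  show "a = 1 \<Longrightarrow> b = 0" "a = -1 \<Longrightarrow> b = 1 + m" using assms by auto
qed

text \<open>
  The space (m, 1) between the two copies pulls back into the image of the main gap under a
  cylinder map. The composition with this map sends F and f_{\<beta>+1}(E) to opposite sides of
  the space, and the preceding section applies to it.
\<close>
lemma no_crossing_separated:
  assumes "m < 1" "a \<noteq> 0" "\<And>x. x \<in> E \<Longrightarrow> a * x + b \<in> two_copies"
    and x12: "x1 \<in> E" "x2 \<in> E" "a * x1 + b < 1" "m < a * x2 + b"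
    and nid: "\<not> (a = 1 \<and> b = 0)"
  shows False
proof -
  have dich: "a * x + b \<le> m \<or> 1 \<le> a * x + b" if "x \<in> E" for x
    using two_copies_low[OF assms(3)[OF that]] by fastforce
  then have x12': "a * x1 + b \<le> m" "1 \<le> a * x2 + b" using x12 by fastforce+
  have abs_a: "\<bar>a\<bar> \<le> 1"
    using two_copies_bounds[OF assms(3)[OF E_ends(1)]] two_copies_bounds[OF assms(3)[OF E_ends(2)]]
    by (intro hull_into(1)) auto
  show False
  proof (cases "0 < a")
    case True
    obtain u v where uv: "gap u v" "a * u + b = m" "a * v + b = 1"
      using crossing_pos[of a x1 x2 b m 1] True x12(1,2) x12' assms(1) dich by metis
    obtain s c where sc: "cylinder s c" "s * m + c \<le> u" "v \<le> s * (1 + r) + c"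
      using gap_in_cylinder[OF uv(1)] .
    have s: "0 < s" "s \<le> 1" "s = 1 \<longrightarrow> c = 0" and cE: "\<And>x. x \<in> E \<Longrightarrow> s * x + c \<in> E"
      using sc(1) by (auto simp: cylinder_def)
    have img: "a * s * x + (a * c + b) = a * (s * x + c) + b" for x by (simp add: algebra_simps)
    have mono: "a * x + b \<le> a * y + b" if "x \<le> y" for x y using True that by simp
    have F: "a * s * x + (a * c + b) \<in> E \<and> a * s * x + (a * c + b) \<le> m" if "x \<in> E" "x \<le> m" for x
    proof -
      have "s * x + c \<le> u" using that s sc(2) mult_left_mono[of x m s] by linarith
      then have "a * (s * x + c) + b \<le> m" using mono uv(2) by metis
      then show ?thesis using two_copies_low[OF assms(3)[OF cE[OF that(1)]]] assms(1)
        unfolding img by simp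
    qed
    have L: "1 \<le> a * s * (1 + r) + (a * c + b)" unfolding img using mono[OF sc(3)] uv(3) by simp
    have "a * s = 1 \<and> a * c + b = 0" by (rule left_part_rigid[OF mult_pos_pos[OF True s(1)] F L])
    moreover have "a * s \<le> 1 * s" "a * s \<le> a * 1"
      using True s abs_a by (auto intro: mult_right_mono mult_left_mono)
    ultimately have "a = 1" "s = 1" "a * c + b = 0" using s abs_a by auto
    then show False using nid s by simp
  next
    case False
    then have a: "a < 0" using assms(2) by simp
    obtain u v where uv: "gap u v" "a * u + b = 1" "a * v + b = m"
      using crossing_neg[of a x2 x1 1 b m] a x12(1,2) x12' assms(1) dich by metis
    obtain s c where sc: "cylinder s c" "s * m + c \<le> u" "v \<le> s * (1 + r) + c"
      using gap_in_cylinder[OF uv(1)] .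
    have s: "0 < s" and cE: "\<And>x. x \<in> E \<Longrightarrow> s * x + c \<in> E"
      using sc(1) by (auto simp: cylinder_def)
    have img: "(a * c + b) - (- a * s) * x = a * (s * x + c) + b" for x
      by (simp add: algebra_simps)
    have anti: "a * y + b \<le> a * x + b" if "x \<le> y" for x y using a that by simp
    show False
    proof (rule no_reflected_placement[of "- a * s" 0 "a * c + b"])
      show "0 < - a * s" using a s by (simp add: mult_neg_pos)
      show "a * c + b - - a * s * x - 1 \<in> E \<and> a * c + b - - a * s * x - 1 \<le> m"
        if "x \<in> E" "x \<le> m" for x
      proof -
        have "s * x + c \<le> u" using that s sc(2) mult_left_mono[of x m s] by linarith
        then have "1 \<le> a * (s * x + c) + b" using anti uv(2) by metis
        then show ?thesis unfolding img using two_copies_high[OF assms(3)[OF cE[OF that(1)]]] by simp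
      qed
      show "a * c + b - - a * s * x - 0 \<in> E \<and> a * c + b - - a * s * x - 0 \<le> m"
        if "x \<in> E" "1 + r \<le> x" for x
      proof -
        have "v \<le> s * x + c" using that s sc(3) mult_left_mono[of "1 + r" x s] by linarith
        then have "a * (s * x + c) + b \<le> m" using anti uv(3) by metis
        then show ?thesis unfolding img
          using two_copies_low[OF assms(3)[OF cE[OF that(1)]]] assms(1) by simp
      qed
    qed simp
  qed
qed


section \<open>No crossing of the junction: touching copies\<close>

lemma touching_third: "m = 1 \<Longrightarrow> r = 1/3"
  using rm by simp

text \<open>
  With G the main gap, these are f_1(G), f_0 f_1(G), f_1 f_1(G) and f_1 f_{\<beta>+1}(G) for \<beta> = 3.
\<close>
lemma touching_gaps:
  assumes "m = 1" "z \<in> E"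
  shows "z \<le> 2/3 \<or> 7/9 \<le> z" "z \<le> 2/9 \<or> 7/27 \<le> z" "z \<le> 5/9 \<or> 16/27 \<le> z"
    "z \<le> 8/9 \<or> 25/27 \<le> z"
proof -
  have r: "r = 1/3" using touching_third assms by simp
  show g1: "z \<le> 2/3 \<or> 7/9 \<le> z" and "z \<le> 2/9 \<or> 7/27 \<le> z"
    using E_gap1[OF assms(2)] E_gap01[OF assms(2)] assms(1) r by auto
  have mid: "3 * z - 1 \<in> E" if "1/3 \<le> z" "z \<le> 1"
    using E_middle[OF assms(2)] that r assms(1) by (simp add: mult.commute)
  have "3 * z - 1 \<le> 2/3 \<or> 7/9 \<le> 3 * z - 1" if "1/3 \<le> z" "z \<le> 1"
    using E_gap1[OF mid[OF that]] assms(1) r by auto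
  then show "z \<le> 5/9 \<or> 16/27 \<le> z" by argo
  show "z \<le> 8/9 \<or> 25/27 \<le> z"
  proof -
    have "3 * z - 2 \<le> 2/3 \<or> 7/9 \<le> 3 * z - 2" if "7/9 \<le> z" "z \<le> 1"
      using E_gap1[of "z / r - 2"] E_top[OF assms(2)] that assms(1) r by (auto simp: mult.commute)
    then show ?thesis using g1 by argo
  qed
qed

text \<open>
  Near its left end 0 the set F is invariant under tripling, so its gaps in [0, 1] persist in
  all its magnifications about 0. The next lemma is the analogue at the right end 1.
\<close>
lemma zoom_right:
  assumes "m = 1" "z \<in> E" "z \<le> 1" "\<And>z. z \<in> E \<Longrightarrow> z \<le> u \<or> v \<le> z" "v \<le> 1"
  shows "3 ^ k * z \<le> u \<or> v \<le> 3 ^ k * z"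
  using assms(2,3)
proof (induction k arbitrary: z)
  case 0
  then show ?case using assms(4) by simp
next
  case (Suc k)
  show ?case
  proof (cases "z < 1/3")
    case True
    then have "3 * z \<in> E \<and> 3 * z \<le> 1"
      using E_low[OF Suc.prems(1)] touching_third assms(1) by (simp add: mult.commute)
    then show ?thesis using Suc.IH[of "3 * z"] by (simp add: mult.assoc mult.left_commute)
  next
    case False
    have "1 * (1/3) \<le> 3 ^ k * z" using False by (intro mult_mono) auto
    then show ?thesis using assms(5) by simp
  qed
qed

lemma zoom_left:
  assumes "m = 1" "z \<in> E" "z \<le> 1" "\<And>z. z \<in> E \<Longrightarrow> z \<le> u \<or> v \<le> z" "2/3 \<le> u"
  shows "3 ^ k * (z - 1) \<le> u - 1 \<or> v - 1 \<le> 3 ^ k * (z - 1)"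
  using assms(2,3)
proof (induction k arbitrary: z)
  case 0
  then show ?case using assms(4) by auto
next
  case (Suc k)
  show ?case
  proof (cases "7/9 \<le> z")
    case True
    then have "3 * z - 2 \<in> E \<and> 3 * z - 2 \<le> 1"
      using E_top[OF Suc.prems(1)] Suc.prems(2) touching_third assms(1) by (simp add: mult.commute)
    moreover have eq: "3 ^ Suc k * (z - 1) = 3 ^ k * (3 * z - 2 - 1)" by (simp add: algebra_simps)
    ultimately show ?thesis unfolding eq using Suc.IH[of "3 * z - 2"] by simp
  next
    case False
    then have "z \<le> 2/3" using touching_gaps(1)[OF assms(1) Suc.prems(1)] by simp
    then have "1 * (1/3) \<le> 3 ^ k * (1 - z)" by (intro mult_mono) auto
    then show ?thesis using assms(5) by (simp add: algebra_simps)
  qed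
qed

text \<open>
  Gaps, on both sides of the junction, of the union of the two copies after it has been magnified
  about 1 by a power of 3. For k = 1 the interval (-3,-2) is not free, but there the left copy ends
  at -3.
\<close>
lemma zoomed_gaps:
  assumes "m = 1" "y \<in> two_copies" "1 \<le> k"
  defines "w \<equiv> 3 ^ k * (y - 1)"
  shows "w \<le> -1 \<or> -2/3 \<le> w" "w \<le> -1/3 \<or> -2/9 \<le> w" "w \<le> -1/9 \<or> -2/27 \<le> w"
    "w \<le> 2/9 \<or> 7/27 \<le> w" "w \<le> 2/3 \<or> 7/9 \<le> w" "w \<le> 5/3 \<or> 16/9 \<le> w"
    "w \<le> 8/3 \<or> 25/9 \<le> w" "k = 1 \<Longrightarrow> - 3 \<le> w" "k \<noteq> 1 \<Longrightarrow> w \<le> -3 \<or> -2 \<le> w"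
proof -
  note gaps = touching_gaps[OF assms(1)]
  have "(w \<le> -1 \<or> -2/3 \<le> w) \<and> (w \<le> -1/3 \<or> -2/9 \<le> w) \<and> (w \<le> -1/9 \<or> -2/27 \<le> w) \<and>
    (w \<le> 2/9 \<or> 7/27 \<le> w) \<and> (w \<le> 2/3 \<or> 7/9 \<le> w) \<and> (w \<le> 5/3 \<or> 16/9 \<le> w) \<and>
    (w \<le> 8/3 \<or> 25/9 \<le> w) \<and> (k = 1 \<longrightarrow> - 3 \<le> w) \<and> (k \<noteq> 1 \<longrightarrow> w \<le> -3 \<or> -2 \<le> w)"
  proof (cases "y < 1")
    case True
    then have y: "y \<in> E" "y \<le> 1" using two_copies_low[OF assms(2)] assms(1) by auto
    obtain j where k: "k = Suc j" using assms(3) by (cases k) auto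
    have "w \<le> 0" using y by (simp add: w_def mult_le_0_iff)
    moreover have "w \<le> -1/3 \<or> -2/9 \<le> w" "w \<le> -1/9 \<or> -2/27 \<le> w"
      using zoom_left[OF assms(1) y gaps(1), of k] zoom_left[OF assms(1) y gaps(4), of k]
      unfolding w_def by simp_all
    moreover have w1: "w = 3 * (3 ^ j * (y - 1))" by (simp add: w_def k)
    have "w \<le> -1 \<or> -2/3 \<le> w"
      using zoom_left[OF assms(1) y gaps(1), of j] w1 by simp argo
    moreover have "k \<noteq> 1 \<longrightarrow> w \<le> -3 \<or> -2 \<le> w"
    proof
      assume "k \<noteq> 1"
      then obtain i where i: "k = Suc (Suc i)" using k by (cases j) auto
      have "w = 9 * (3 ^ i * (y - 1))" by (simp add: w_def i)
      then show "w \<le> -3 \<or> -2 \<le> w"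
        using zoom_left[OF assms(1) y gaps(1), of i] by simp argo
    qed
    moreover have "k = 1 \<longrightarrow> -3 \<le> w" using E_bounds(1)[OF y(1)] by (simp add: w_def)
    ultimately show ?thesis by simp
  next
    case False
    then have z: "y - 1 \<in> E" "y - 1 \<le> 1" using two_copies_high[OF assms(2)] assms(1) by auto
    then have z3: "(y - 1) / 3 \<in> E" "(y - 1) / 3 \<le> 1"
      using E_f0[OF z(1)] touching_third assms(1) by auto
    have third: "3 ^ k * ((y - 1) / 3) = w / 3" by (simp add: w_def)
    have "0 \<le> w" using False by (simp add: w_def)
    moreover have R: "w \<le> u \<or> v \<le> w"
      if "v \<le> 1" "\<And>z. z \<in> E \<Longrightarrow> z \<le> u \<or> v \<le> z" for u v
      using zoom_right[OF assms(1) z that(2,1), of k] unfolding w_def by simp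
    have "w \<le> 2/9 \<or> 7/27 \<le> w" "w \<le> 2/3 \<or> 7/9 \<le> w"
      using gaps by (intro R; simp)+
    moreover have R3: "w / 3 \<le> u \<or> v \<le> w / 3"
      if "v \<le> 1" "\<And>z. z \<in> E \<Longrightarrow> z \<le> u \<or> v \<le> z" for u v
      using zoom_right[OF assms(1) z3 that(2,1), of k] third by simp
    have "w / 3 \<le> 5/9 \<or> 16/27 \<le> w / 3" "w / 3 \<le> 8/9 \<or> 25/27 \<le> w / 3"
      using gaps by (intro R3; simp)+
    then have "w \<le> 5/3 \<or> 16/9 \<le> w" "w \<le> 8/3 \<or> 25/9 \<le> w" by argo+
    ultimately show ?thesis by simp
  qed
  then show "w \<le> -1 \<or> -2/3 \<le> w" "w \<le> -1/3 \<or> -2/9 \<le> w" "w \<le> -1/9 \<or> -2/27 \<le> w"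
    "w \<le> 2/9 \<or> 7/27 \<le> w" "w \<le> 2/3 \<or> 7/9 \<le> w" "w \<le> 5/3 \<or> 16/9 \<le> w"
    "w \<le> 8/3 \<or> 25/9 \<le> w" "k = 1 \<Longrightarrow> - 3 \<le> w" "k \<noteq> 1 \<Longrightarrow> w \<le> -3 \<or> -2 \<le> w" by blast+
qed

text \<open>
  Every gap of E longer than 1/27 lies in the main gap, of length 1/3, or in its image under f_1 or
  f_{\<beta>+1}, of length 1/9. The image under f_0 is not among them, since it lies in the hull of
  f_1 f_0(E).
\<close>
lemma touching_large_gap:
  assumes "m = 1" "gap u v" "1/27 < v - u"
  shows "(1 \<le> u \<and> v \<le> 4/3) \<or> (2/3 \<le> u \<and> v \<le> 7/9) \<or> (5/3 \<le> u \<and> v \<le> 16/9)"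
proof -
  have r: "r = 1/3" using touching_third assms by simp
  have L: "1 \<le> x \<and> y \<le> 4/3" if "gap x y" "1/9 < y - x" for x y
    using large_gap[OF that(1)] that(2) r assms(1) by simp
  from assms(2) show ?thesis
  proof (cases rule: gap_step)
    case 1 then show ?thesis using r assms(1) by simp
  next
    case 2 then show ?thesis using L[of "u / r" "v / r"] assms(3) r by auto
  next
    case 3 then show ?thesis using L[of "(u - r) / r" "(v - r) / r"] assms(3) r by auto
  next
    case 4 then show ?thesis using L[of "(u - (1+r)) / r" "(v - (1+r)) / r"] assms(3) r by auto
  qed
qed

lemma touching_medium_gap:
  assumes "m = 1" "gap u v" "1/81 < v - u"
  shows "(1 \<le> u \<and> v \<le> 4/3) \<or> (2/3 \<le> u \<and> v \<le> 7/9) \<or> (5/3 \<le> u \<and> v \<le> 16/9) \<or>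
    (2/9 \<le> u \<and> v \<le> 7/27) \<or> (5/9 \<le> u \<and> v \<le> 16/27) \<or> (8/9 \<le> u \<and> v \<le> 25/27) \<or>
    (14/9 \<le> u \<and> v \<le> 43/27) \<or> (17/9 \<le> u \<and> v \<le> 52/27)"
proof -
  have r: "r = 1/3" using touching_third assms by simp
  note L = touching_large_gap[OF assms(1)]
  from assms(2) show ?thesis
  proof (cases rule: gap_step)
    case 1 then show ?thesis using r assms(1) by simp
  next
    case 2 then show ?thesis using L[of "u / r" "v / r"] assms(2,3) r by (auto simp: gap_def)
  next
    case 3 then show ?thesis using L[of "(u - r) / r" "(v - r) / r"] assms(3) r by auto
  next
    case 4 then show ?thesis using L[of "(u - (1+r)) / r" "(v - (1+r)) / r"] assms(3) r by auto
  qed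
qed

text \<open>
  A map x \<mapsto> a x + b of [0, 2] either does not cross the interval (p, q) or maps one of the long gaps
  of E over it. In the finer version the gaps of length 1/27 are admitted as well.
\<close>
definition covered :: "real \<Rightarrow> real \<Rightarrow> real \<Rightarrow> real \<Rightarrow> bool" where
  "covered a b p q \<longleftrightarrow> q \<le> b \<or> a * 2 + b \<le> p \<or>
    (a * 1 + b \<le> p \<and> q \<le> a * (4/3) + b) \<or> (a * (2/3) + b \<le> p \<and> q \<le> a * (7/9) + b) \<or>
    (a * (5/3) + b \<le> p \<and> q \<le> a * (16/9) + b)"

definition covered_fine :: "real \<Rightarrow> real \<Rightarrow> real \<Rightarrow> real \<Rightarrow> bool" where
  "covered_fine a b p q \<longleftrightarrow> covered a b p q \<or>
    (a * (2/9) + b \<le> p \<and> q \<le> a * (7/27) + b) \<or> (a * (5/9) + b \<le> p \<and> q \<le> a * (16/27) + b) \<or>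
    (a * (8/9) + b \<le> p \<and> q \<le> a * (25/27) + b) \<or> (a * (14/9) + b \<le> p \<and> q \<le> a * (43/27) + b) \<or>
    (a * (17/9) + b \<le> p \<and> q \<le> a * (52/27) + b)"

lemma crossed_gap_pulls_back:
  assumes "m = 1" "0 < a" "p < q" "\<And>x. x \<in> E \<Longrightarrow> a * x + b \<le> p \<or> q \<le> a * x + b"
    and "\<not> q \<le> b" "\<not> a * 2 + b \<le> p"
  obtains u v where "gap u v" "a * u + b = p" "a * v + b = q"
proof -
  have E02: "0 \<in> E" "2 \<in> E" using E_ends assms(1) by auto
  have "a * 0 + b \<le> p" "q \<le> a * 2 + b"
    using assms(4)[OF E02(1)] assms(4)[OF E02(2)] assms(5,6) by auto
  then show thesis using crossing_pos[OF assms(2) E02 _ _ assms(3)] assms(4) that by metis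
qed

lemma pulled_back_length:
  fixes a :: real
  assumes "a < 3" "u < v" "a * u + b = p" "a * v + b = q" "p + 3 * t \<le> q"
  shows "t < v - u"
proof -
  have "a * (v - u) < 3 * (v - u)" using assms(1,2) by (intro mult_strict_right_mono) auto
  moreover have "a * (v - u) = q - p"
    unfolding right_diff_distrib assms(3,4)[symmetric] by simp
  ultimately show ?thesis using assms(5) by simp
qed

text \<open>
  A target gap of length 1/9 pulls back, under a ratio below 3, to a gap longer than 1/27, and those
  are known. In the same way a target gap of length 1/27 pulls back to one longer than 1/81.
\<close>
lemma gap_covered:
  assumes "m = 1" "0 < a" "a < 3" "p + 1/9 \<le> q" "\<And>x. x \<in> E \<Longrightarrow> a * x + b \<le> p \<or> q \<le> a * x + b"
  shows "covered a b p q"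
proof (rule ccontr)
  assume no: "\<not> ?thesis"
  have "p < q" using assms(4) by simp
  then obtain u v where uv: "gap u v" "a * u + b = p" "a * v + b = q"
    using crossed_gap_pulls_back[OF assms(1,2) _ assms(5)] no unfolding covered_def by blast
  have "1/27 < v - u"
    using pulled_back_length[OF assms(3) _ uv(2,3), of "1/27"] uv(1) assms(4) by (simp add: gap_def)
  note g = touching_large_gap[OF assms(1) uv(1) this]
  have "a * x + b \<le> p" if "x \<le> u" for x using that assms(2) uv(2) by (simp flip: uv(2))
  moreover have "q \<le> a * y + b" if "v \<le> y" for y using that assms(2) by (simp flip: uv(3))
  ultimately show False using g no unfolding covered_def by blast
qed

lemma gap_covered_fine:
  assumes "m = 1" "0 < a" "a < 3" "p + 1/27 \<le> q" "\<And>x. x \<in> E \<Longrightarrow> a * x + b \<le> p \<or> q \<le> a * x + b"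
  shows "covered_fine a b p q"
proof (rule ccontr)
  assume no: "\<not> ?thesis"
  have "p < q" using assms(4) by simp
  then obtain u v where uv: "gap u v" "a * u + b = p" "a * v + b = q"
    using crossed_gap_pulls_back[OF assms(1,2) _ assms(5)] no
    unfolding covered_fine_def covered_def by blast
  have "1/81 < v - u"
    using pulled_back_length[OF assms(3) _ uv(2,3), of "1/81"] uv(1) assms(4) by (simp add: gap_def)
  note g = touching_medium_gap[OF assms(1) uv(1) this]
  have "a * x + b \<le> p" if "x \<le> u" for x using that assms(2) uv(2) by (simp flip: uv(2))
  moreover have "q \<le> a * y + b" if "v \<le> y" for y using that assms(2) by (simp flip: uv(3))
  ultimately show False using g no unfolding covered_fine_def covered_def by blast
qed

text \<open>
  The image crosses the junction, which is now at 0. The target gaps are taken in an order in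
  which the conditions already obtained leave few choices for the gap of E that covers
  the next one.
\<close>
lemma no_zoomed_crossing_pos:
  fixes a b :: real
  assumes "1 \<le> a" "a < 3" "b < 0" "0 < a * 2 + b" "-3 \<le> b"
    and "covered a b (-1) (-2/3)" "covered a b (-1/3) (-2/9)"
    and "covered a b (2/3) (7/9)" "covered a b (5/3) (16/9)"
  shows False
proof -
  note c = assms(6-9)[unfolded covered_def]
  consider "-2/3 \<le> b" | "a + b \<le> -1" "-2/3 \<le> a * (4/3) + b" using c(1) assms(1-5) by argo
  then show False
  proof cases
    case 1
    then have b: "-2/9 \<le> b" using c(2) assms(1-5) by argo
    then have "a * (2/3) + b \<le> 2/3" "7/9 \<le> a * (7/9) + b" using c(3) assms(1-5) by argo+
    then show False using c(4) b assms(1-5) by argo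
  next
    case 2
    then show False using c(2) assms(1-5) by argo
  qed
qed

text \<open>
  Orientation-reversing maps are composed with x \<mapsto> -x, so the intervals here are the mirror images
  of target gaps. Besides gaps of length 1/9 or more, two gaps of length 1/27 enter here.
\<close>
lemma no_zoomed_crossing_neg:
  fixes a b :: real
  assumes "1 \<le> a" "a < 3" "b < 0" "0 < a * 2 + b"
    and "covered a b (2/3) 1" "covered a b (2/9) (1/3)" "covered a b (-7/9) (-2/3)"
    and "covered a b (-16/9) (-5/3)" "covered a b (-25/9) (-8/3)"
    and "covered_fine a b (2/27) (1/9)" "covered_fine a b (-7/27) (-2/9)"
  shows False
proof -
  note c = assms(5-9)[unfolded covered_def]
    and f = assms(10,11)[unfolded covered_fine_def covered_def]
  consider (low) "a * 2 + b \<le> 2/3" | (G) "a + b \<le> 2/3" "1 \<le> a * (4/3) + b"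
    using c(1) assms(1-4) by argo
  then show False
  proof cases
    case low
    then consider (low') "a * 2 + b \<le> 2/9" | (A2) "a * (5/3) + b \<le> 2/9" "1/3 \<le> a * (16/9) + b"
      using c(2) assms(1-4) by argo
    then show False
    proof cases
      case low'
      then consider "a + b \<le> -7/9" "-2/3 \<le> a * (4/3) + b"
        | "a * (5/3) + b \<le> -7/9" "-2/3 \<le> a * (16/9) + b"
        using c(3) assms(1-4) by argo
      then show False
      proof cases
        case 1
        then show False using c(4) low' assms(1-4) by argo
      next
        case 2
        then have "a + b \<le> -16/9" "-5/3 \<le> a * (4/3) + b"
          using c(4) low' assms(1-4) by argo+
        then show False using c(5) 2 assms(1-4) by argo
      qed
    next
      case A2
      then have "-5/3 \<le> b" using c(4) low assms(1-4) by argo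
      then show False using f(1) A2 low assms(1-4) by argo
    qed
  next
    case G
    then have b: "-5/3 \<le> b" using c(4) assms(1-4) by argo
    then have "a * (2/3) + b \<le> 2/9" "1/3 \<le> a * (7/9) + b" using c(2) G assms(1-4) by argo+
    then show False using f(2) G b assms(1-4) by argo
  qed
qed

lemma zoom_exponent:
  fixes a :: real
  assumes "0 < a" "a < 1"
  obtains k where "1 \<le> k" "1 \<le> 3 ^ k * a" "3 ^ k * a < 3"
proof -
  define k where "k = (LEAST n. 1 \<le> 3 ^ n * a)"
  obtain n where "1 / a < 3 ^ n" using real_arch_pow[of 3 "1 / a"] by auto
  then have "1 \<le> 3 ^ n * a" using assms(1) by (simp add: field_simps)
  then have k: "1 \<le> 3 ^ k * a" unfolding k_def by (rule LeastI)
  then obtain j where j: "k = Suc j" using assms(2) by (cases k) auto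
  have "\<not> 1 \<le> 3 ^ j * a" using not_less_Least[of j "\<lambda>n. 1 \<le> 3 ^ n * a"] j by (simp add: k_def)
  then show thesis using that[of k] k j by simp
qed

text \<open>
  Ratio 1 in modulus is left to the identity and to the reflection of the hull, which fails by
  reflected_point. For smaller ratios a power of 3 brings the ratio into [1, 3), and the two
  preceding inconsistencies apply.
\<close>
lemma no_crossing_touching:
  assumes "m = 1" "a \<noteq> 0" "\<And>x. x \<in> E \<Longrightarrow> a * x + b \<in> two_copies"
    and x12: "x1 \<in> E" "x2 \<in> E" "a * x1 + b < 1" "1 < a * x2 + b"
    and nid: "\<not> (a = 1 \<and> b = 0)"
  shows False
proof -
  have bd: "0 \<le> b \<and> b \<le> 1 + m" "0 \<le> a * (1 + m) + b \<and> a * (1 + m) + b \<le> 1 + m"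
    using two_copies_bounds assms(3)[OF E_ends(1)] assms(3)[OF E_ends(2)] by simp_all
  have "\<bar>a\<bar> \<noteq> 1"
  proof
    assume "\<bar>a\<bar> = 1"
    then have ab: "a = -1" "b = 1 + m" using hull_into[of b a] bd nid by (auto simp: abs_if split: if_splits)
    have y: "r * (r * (2 + r)) \<in> E"
      using E_f0[OF E_f1[OF E_points(2)]] by (simp add: algebra_simps)
    have "r * (r * (2 + r)) \<le> 1" unfolding touching_third[OF assms(1)] by simp
    then have "m - r * (r * (2 + r)) \<in> E"
      using two_copies_high[OF assms(3)[OF y]] ab assms(1) by simp
    then show False using reflected_point by simp
  qed
  then have "\<bar>a\<bar> < 1" using hull_into(1)[of b a] bd by simp
  then obtain k where k: "1 \<le> k" "1 \<le> 3 ^ k * \<bar>a\<bar>" "3 ^ k * \<bar>a\<bar> < 3"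
    using zoom_exponent[of "\<bar>a\<bar>"] assms(2) by auto
  define A B where AB: "A = 3 ^ k * a" "B = 3 ^ k * (b - 1)"
  have img: "A * x + B = 3 ^ k * (a * x + b - 1)" for x by (simp add: AB algebra_simps)
  note Z = zoomed_gaps[OF assms(1) assms(3) k(1), folded img]
  have x1: "A * x1 + B < 0" and x2: "0 < A * x2 + B"
    unfolding img using x12 by (simp_all add: mult_less_0_iff zero_less_mult_iff)
  have E02: "0 \<in> E" "2 \<in> E" using E_ends assms(1) by auto
  have bx: "0 \<le> x1" "x1 \<le> 2" "0 \<le> x2" "x2 \<le> 2" using E_bounds x12 assms(1) by fastforce+
  show False
  proof (cases "0 < A")
    case True
    have A: "1 \<le> A" "A < 3" using k True by (auto simp: AB abs_mult zero_less_mult_iff)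
    note cov = gap_covered[OF assms(1) True A(2)]
    have "0 \<le> A * x1" "A * x2 \<le> A * 2" using True bx by auto
    then have hull: "B < 0" "0 < A * 2 + B" using x1 x2 by linarith+
    have B3: "-3 \<le> B"
    proof (cases "k = 1")
      case True
      then show ?thesis using Z(8)[OF E02(1)] by simp
    next
      case False
      have "covered A B (-3) (-2)" by (rule cov) (use Z(9)[OF _ False] in auto)
      then show ?thesis using A hull unfolding covered_def by argo
    qed
    show False
      by (rule no_zoomed_crossing_pos[OF A hull B3]; rule cov) (use Z in auto)
  next
    case False
    define C D where CD: "C = - A" "D = - B"
    have Cpos: "0 < C" using False assms(2) by (auto simp: AB CD zero_less_mult_iff mult_less_0_iff)
    have C: "1 \<le> C" "C < 3" using k Cpos by (auto simp: AB CD abs_mult mult_less_0_iff)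
    have neg: "C * x + D \<le> p \<or> q \<le> C * x + D" if "A * x + B \<le> - q \<or> - p \<le> A * x + B" for p q x
      using that by (auto simp: CD)
    note cov = gap_covered[OF assms(1) Cpos C(2) _ neg] gap_covered_fine[OF assms(1) Cpos C(2) _ neg]
    have "0 \<le> C * x2" "C * x1 \<le> C * 2" using Cpos bx by auto
    then have hull: "D < 0" "0 < C * 2 + D" using x1 x2 unfolding CD by linarith+
    show False
      by (rule no_zoomed_crossing_neg[OF C hull]; rule cov) (use Z in auto)
  qed
qed

section \<open>Self-embeddings\<close>

text \<open>
  If the image crossed the main gap, the pulled back gap would be at least as long, so the ratio
  is 1 in modulus. A reflection of the hull would have to preserve the main gap, which is not in
  the middle of the hull.
\<close>
lemma avoid_main_gap:
  assumes "a \<noteq> 0" "\<And>x. x \<in> E \<Longrightarrow> a * x + b \<in> E" "\<not> (a = 1 \<and> b = 0)"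
    and "x1 \<in> E" "x2 \<in> E" "a * x1 + b \<le> m" "1 + r \<le> a * x2 + b"
  shows False
proof -
  have dich: "a * x + b \<le> m \<or> 1 + r \<le> a * x + b" if "x \<in> E" for x
    using E_split assms(2) that by blast
  note hull = hull_into[of b a, OF E_bounds(1)[of b] E_bounds(2)[of b]
      E_bounds(1)[of "a * (1 + m) + b"] E_bounds(2)[of "a * (1 + m) + b"]]
  have bE: "b \<in> E" "a * (1 + m) + b \<in> E" using assms(2)[OF E_ends(1)] assms(2)[OF E_ends(2)] by auto
  have g: "r * (1 + r - m) < 1 * (1 + r - m)"
    using main_gap_pos r_le by (intro mult_strict_right_mono) auto
  show False
  proof (cases "0 < a")
    case True
    obtain u v where uv: "gap u v" "a * u + b = m" "a * v + b = 1 + r"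
      using crossing_pos[of a x1 x2 b m "1 + r"] True assms(4-7) main_gap_pos dich
      by (metis diff_gt_0_iff_gt)
    have "a < 1" using hull bE assms(3) True by fastforce
    have "a * (v - u) = 1 + r - m" using uv by (simp add: algebra_simps)
    moreover have "a * (v - u) < 1 * (v - u)" using \<open>a < 1\<close> uv(1)
      by (intro mult_strict_right_mono) (auto simp: gap_def)
    ultimately show False using gap_length[OF uv(1)] by simp
  next
    case False
    then have a: "a < 0" using assms(1) by simp
    obtain u v where uv: "gap u v" "a * u + b = 1 + r" "a * v + b = m"
      using crossing_neg[of a x2 x1 "1 + r" b m] a assms(4-7) main_gap_pos dich
      by (metis diff_gt_0_iff_gt)
    have eq: "- a * (v - u) = 1 + r - m" using uv by (simp add: algebra_simps)
    have a1: "a = -1"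
    proof (rule ccontr)
      assume "a \<noteq> -1"
      then have "- a < 1" using hull(1) bE by auto
      then have "- a * (v - u) < 1 * (v - u)" using uv(1)
        by (intro mult_strict_right_mono) (auto simp: gap_def)
      then show False using gap_length[OF uv(1)] eq by simp
    qed
    then have "b = 1 + m" using hull(3) bE by auto
    moreover have "m \<le> u" "v \<le> 1 + r" using large_gap[OF uv(1)] eq a1 g by auto
    ultimately show False using uv a1 r_pos m_le by auto
  qed
qed

text \<open>
  The offsets 0, r and 1+r are those of the three maps x \<mapsto> r x + e of the system, so the conclusion says
  that the image of E lies in one of the three pieces.
\<close>
lemma inside_first_level:
  assumes a: "a \<noteq> 0" and gE: "\<And>x. x \<in> E \<Longrightarrow> a * x + b \<in> E" and nid: "\<not> (a = 1 \<and> b = 0)"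
  shows "\<exists>e. (e = 0 \<or> e = r \<or> e = 1 + r) \<and> (\<forall>x\<in>E. (a * x + b - e) / r \<in> E)"
proof (cases "\<exists>x\<in>E. a * x + b \<le> m")
  case False
  then have "\<forall>x\<in>E. (a * x + b - (1 + r)) / r \<in> E"
    using E_right gE by (fastforce simp: algebra_simps)
  then show ?thesis by blast
next
  case True
  then have le_m: "a * x + b \<le> m" if "x \<in> E" for x
    using avoid_main_gap[OF a gE nid] E_split gE that by blast
  show ?thesis
  proof (rule ccontr)
    assume contra: "\<not> ?thesis"
    obtain x1 where x1: "x1 \<in> E" "(a * x1 + b - r) / r \<notin> E" using contra by blast
    obtain x2 where x2: "x2 \<in> E" "(a * x2 + b - 0) / r \<notin> E" using contra by blast
    have p: "a * x1 + b < r"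
      using E_middle[OF gE _ le_m] x1 r_pos by (fastforce simp: diff_divide_distrib)
    have q: "r \<le> a * x2 + b"
      using E_low[OF gE] x2 by fastforce
    have abs_a: "\<bar>a\<bar> * (1 + m) \<le> m"
      using E_bounds(1)[OF gE[OF E_ends(1)]] E_bounds(1)[OF gE[OF E_ends(2)]]
        le_m[OF E_ends(1)] le_m[OF E_ends(2)] by (auto simp: abs_if)
    \<comment> \<open>The image does not cross f_1(G). Otherwise this gap pulls back into the main gap, so |a| is at
      least r. The part beyond f_1(G) is so short that this forces the map to be f_1 itself.\<close>
    have low: "a * x + b \<le> r * (1 + m)" if xE: "x \<in> E" for x
    proof (rule ccontr)
      assume "\<not> a * x + b \<le> r * (1 + m)"
      then have x: "r * (2 + r) \<le> a * x + b" using E_gap1 gE xE by blast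
      have x1': "a * x1 + b \<le> r * (1 + m)" using p r_pos m_bounds
        by (smt (verit) mult_less_cancel_left1)
      have dich: "a * x + b \<le> r * (1 + m) \<or> r * (2 + r) \<le> a * x + b" if "x \<in> E" for x
        using E_gap1 gE that by blast
      have rg: "r * (1 + m) < r * (2 + r)" using r_gap r_pos main_gap_pos
        by (simp add: mult_strict_left_mono)
      have abs1: "\<bar>a\<bar> < 1"
      proof (rule ccontr)
        assume "\<not> \<bar>a\<bar> < 1"
        then have "1 * (1 + m) \<le> \<bar>a\<bar> * (1 + m)" using m_bounds by (intro mult_right_mono) auto
        then show False using abs_a by simp
      qed
      have inG: "m \<le> u \<and> v \<le> 1 + r" if "gap u v" "\<bar>a\<bar> * (v - u) = r * (1 + r - m)" for u v
      proof -
        have "r * (1 + r - m) < v - u"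
          using no_large_crossing[of "\<bar>a\<bar>" v u] that(2) abs1 a by fastforce
        then show ?thesis using large_gap[OF that(1)] by simp
      qed
      show False
      proof (cases "0 < a")
        case True
        obtain u v where uv: "gap u v" "a * u + b = r * (1 + m)" "a * v + b = r * (2 + r)"
          using crossing_pos[of a x1 x b "r * (1 + m)" "r * (2 + r)"] True x1(1) xE x x1' rg dich
          by metis
        have len: "a * (v - u) = r * (1 + r - m)" using uv r_gap by (simp add: algebra_simps)
        then have in_G: "m \<le> u" "v \<le> 1 + r" using inG[OF uv(1)] True by auto
        have "a * (1 + m - v) \<le> r * (1 + m - (1 + r))"
        proof -
          have "a * (1 + m - v) = (a * (1 + m) + b) - (a * v + b)" by (simp add: algebra_simps)
          also have "\<dots> \<le> m - r * (2 + r)" using le_m[OF E_ends(2)] uv(3) by simp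
          also have "\<dots> = r * (1 + m - (1 + r))" using rm by (simp add: algebra_simps)
          finally show ?thesis .
        qed
        moreover have "a * (m - r) \<le> a * (1 + m - v)" using True in_G by simp
        ultimately have "a * (m - r) \<le> r * (m - r)" by simp
        then have "a \<le> r" using m_bounds r_pos by simp
        moreover have "r \<le> a"
        proof -
          have "a * (v - u) \<le> a * (1 + r - m)" using True in_G by simp
          then show ?thesis using len main_gap_pos by simp
        qed
        ultimately have ar: "a = r" by simp
        then have "v - u = 1 + r - m" using len r_pos by simp
        then have "u = m" "v = 1 + r" using in_G by auto
        then have "b = r" using uv(2) ar by (simp add: algebra_simps)
        then show False using x1 ar r_pos by simp
      next
        case False
        then have an: "a < 0" using a by simp
        obtain u v where uv: "gap u v" "a * u + b = r * (2 + r)" "a * v + b = r * (1 + m)"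
          using crossing_neg[of a x x1 "r * (2 + r)" b "r * (1 + m)"] an x1(1) xE x x1' rg dich
          by metis
        have len: "- a * (v - u) = r * (1 + r - m)" using uv r_gap by (simp add: algebra_simps)
        then have in_G: "m \<le> u" "v \<le> 1 + r" using inG[OF uv(1)] an by auto
        have "- a * u \<le> m - r * (2 + r)" using le_m[OF E_ends(1)] uv(2) by simp
        moreover have "- a * m \<le> - a * u" using an in_G by simp
        moreover have "m - r * (2 + r) = r * (m - r)" using rm by (simp add: algebra_simps)
        moreover have "r * m \<le> - a * m"
        proof -
          have "r * (1 + r - m) \<le> - a * (1 + r - m)" unfolding len[symmetric] using an in_G by simp
          then have "r \<le> - a" by (rule mult_right_le_imp_le[OF _ main_gap_pos])
          then show ?thesis using m_bounds by (intro mult_right_mono) auto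
        qed
        ultimately have "r * m \<le> r * (m - r)" by linarith
        then show False using r_pos by simp
      qed
    qed
    \<comment> \<open>What remains of F is r times the union of two copies of F; x1 and x2 lie on different sides.\<close>
    have h: "a / r * x + b / r \<in> two_copies" if "x \<in> E" for x
    proof -
      have e: "a / r * x + b / r = (a * x + b) / r" by (simp add: add_divide_distrib)
      show ?thesis
      proof (cases "a * x + b < r")
        case True
        then show ?thesis unfolding e two_copies_def using E_low gE[OF that] by blast
      next
        case False
        then have "(a * x + b) / r - 1 \<in> E" using E_middle[OF gE _ le_m] that by simp
        moreover have "(a * x + b) / r - 1 \<le> m" using low[OF that] r_pos by (simp add: field_simps)
        ultimately show ?thesis unfolding e two_copies_def by blast
      qed
    qed
    have h1: "a / r * x1 + b / r < 1" using p r_pos by (simp add: field_simps)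
    have h2: "1 \<le> a / r * x2 + b / r" "a / r * x2 + b / r \<notin> E"
      using q x2 r_pos by (auto simp: field_simps)
    have a': "a / r \<noteq> 0" using a r_pos by simp
    have nid': "\<not> (a / r = 1 \<and> b / r = 0)" using h2(2) x2(1) by auto
    show False
    proof (cases "m < 1")
      case True
      then show False using no_crossing_separated[OF True a' h x1(1) x2(1) h1 _ nid'] h2 by simp
    next
      case False
      then have m1: "m = 1" using m_le by simp
      then have "a / r * x2 + b / r \<noteq> 1" using h2(2) E_points(1) by metis
      then show False using no_crossing_touching[OF m1 a' h x1(1) x2(1) h1 _ nid'] h2 by simp
    qed
  qed
qed

text \<open>
  Each letter that is stripped multiplies the ratio by 1/r, while the ratio of a self-embedding
  stays at most 1 in modulus.
\<close>
lemma embedding_is_word: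
  assumes "a \<noteq> 0" "\<And>x. x \<in> E \<Longrightarrow> a * x + b \<in> E" "\<not> (a = 1 \<and> b = 0)"
  shows "\<exists>w\<in>Omega_star \<beta>. (\<lambda>x. a * x + b) = fword \<beta> w"
proof -
  obtain n where "r ^ n < \<bar>a\<bar>" using real_arch_pow_inv[of "\<bar>a\<bar>" r] assms(1) r_le by auto
  then show ?thesis using assms
  proof (induction n arbitrary: a b)
    case (0 a b)
    have "b \<in> E" "a * (1 + m) + b \<in> E"
      using "0.prems"(3)[OF E_ends(1)] "0.prems"(3)[OF E_ends(2)] by auto
    then have "\<bar>a\<bar> \<le> 1" by (intro hull_into(1)[where b = b]) (auto intro: E_bounds)
    then show ?case using 0 by simp
  next
    case (Suc n a b)
    obtain e where e: "e = 0 \<or> e = r \<or> e = 1 + r" "\<forall>x\<in>E. (a * x + b - e) / r \<in> E"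
      using inside_first_level Suc.prems(2-4) by blast
    obtain d where d: "d \<in> Omega \<beta>" "\<And>x. fmap \<beta> d x = r * x + e"
    proof -
      have "\<exists>d\<in>Omega \<beta>. \<forall>x. fmap \<beta> d x = r * x + e"
        unfolding Omega_def using e(1) by (elim disjE) (auto simp: fmap_simps distrib_left)
      then show thesis using that by blast
    qed
    have fac: "(\<lambda>x. a * x + b) = fmap \<beta> d \<circ> (\<lambda>x. a / r * x + (b - e) / r)"
      using r_pos by (auto simp: d(2) fun_eq_iff field_simps)
    show ?case
    proof (cases "a / r = 1 \<and> (b - e) / r = 0")
      case True
      then have "(\<lambda>x. a * x + b) = fword \<beta> [d]" using fac by (auto simp: fword_def fun_eq_iff)
      moreover have "[d] \<in> Omega_star \<beta>" using d(1) by (auto simp: Omega_star_def blocks_def)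
      ultimately show ?thesis by blast
    next
      case False
      have "a / r * x + (b - e) / r \<in> E" if "x \<in> E" for x
      proof -
        have "a / r * x + (b - e) / r = (a * x + b - e) / r"
          by (simp add: add_divide_distrib diff_divide_distrib)
        then show ?thesis using e(2) that by simp
      qed
      moreover have "r ^ n < \<bar>a / r\<bar>" "a / r \<noteq> 0"
        using Suc.prems r_pos by (auto simp: field_simps)
      ultimately obtain w where w: "w \<in> Omega_star \<beta>"
          "(\<lambda>x. a / r * x + (b - e) / r) = fword \<beta> w"
        using Suc.IH False by blast
      have "(\<lambda>x. a * x + b) = fword \<beta> (d # w)" unfolding fac w(2) by (simp add: fword_def)
      moreover have "d # w \<in> Omega_star \<beta>" using d(1) w(1)
        by (auto simp: Omega_star_def blocks_def)
      ultimately show ?thesis by blast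
    qed
  qed
qed

end

theorem theorem1p1:
  fixes \<beta> :: real and E :: "real set" and g :: "real \<Rightarrow> real"
  assumes "\<beta> \<ge> 3"
    and "self_similar_set (fmap \<beta> ` Omega \<beta>) E"
    and "affine_map g"
    and "g \<noteq> id"
    and "g ` E \<subseteq> E"
  shows "\<exists>w\<in>Omega_star \<beta>. g = fword \<beta> w"
proof -
  interpret overlapping_ifs \<beta> E using assms(1,2) by unfold_locales
  obtain a b where g: "a \<noteq> 0" "g = (\<lambda>x. a * x + b)" using assms(3) by (auto simp: affine_map_def)
  have "\<not> (a = 1 \<and> b = 0)" using assms(4) g(2) by (auto simp: fun_eq_iff)
  moreover have "a * x + b \<in> E" if "x \<in> E" for x using assms(5) g(2) that by auto
  ultimately show ?thesis using embedding_is_word[OF g(1)] g(2) by blast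
qed

end
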